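(* Let $b\in\mathbb N$ and let $(x_0,x_1,\dots,x_b)$ be an arbitrary probability distribution on $\{0,1,\dots,b\}$. For $0\le i\le b$ put $z_i=x_0+\cdots+x_i$. Let $\mathbf n=(n_1,\dots,n_b)$ denote a configuration. Then the stationary probability distribution $\pi$ of the Infinite Reverse Juggling Markov Chain (IRJMC) is given by $$\pi(\mathbf n)=\frac{1}{Z_b}\prod_{i=0}^{b-1} z_i^{\,n_{i+1}-n_i-1},$$ where we set $n_0=0$ and $Z_b$ is the partition function (the normalizing constant).
   Context: The Infinite Reverse Juggling Markov Chain (IRJMC) has as states (configurations) the tuples $\mathbf n=(n_1,\dots,n_b)$ of integers with $1\le n_1<\dots<n_b$ (the positions of the $b$ ones in a semi-infinite binary word $w_1w_2\cdots$). Its transitions from $\mathbf n$ are: to $(n_1+1,\dots,n_b+1)$ with probability $x_0$; and, for each $1\le i\le b$, to $(1,n_1+1,\dots,n_{i-1}+1,n_{i+1}+1,\dots,n_b+1)$ (the entry $n_i+1$ is omitted) with probability $x_i$. A power with exponent $0$ is read as $1$.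
   Formalization: Existence and uniqueness of the stationary distribution are claimed only for x_b > 0; if b ≥ 1 and x_b = 0, n_b grows by 1 at every step, so no stationary distribution exists and Z_b diverges. The formula is proved for every stationary distribution, for arbitrary x. *)

theory Defs
  imports "HOL-Probability.Probability"
begin

text \<open>A configuration \<open>(n\<^sub>1, \<dots>, n\<^sub>b)\<close> is the list \<open>[n\<^sub>1, \<dots>, n\<^sub>b]\<close>, so \<open>n\<^sub>i\<close> is \<open>n ! (i - 1)\<close>.\<close>

definition irjmc_configs :: "nat \<Rightarrow> nat list set" where
  "irjmc_configs b = {n. length n = b \<and> sorted_wrt (<) n \<and> (\<forall>k\<in>set n. 1 \<le> k)}"

text \<open>Only the moves \<open>0 \<le> i \<le> b\<close> are meaningful. For \<open>i \<ge> 1\<close> the list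
  \<open>take (i - 1) n @ drop i n\<close> is \<open>n\<close> without its entry \<open>n\<^sub>i\<close>.\<close>

definition irjmc_move :: "nat list \<Rightarrow> nat \<Rightarrow> nat list" where
  "irjmc_move n i =
     (if i = 0 then map Suc n else 1 # map Suc (take (i - 1) n @ drop i n))"

definition irjmc_kernel :: "nat pmf \<Rightarrow> nat list \<Rightarrow> nat list pmf" where
  "irjmc_kernel x n = map_pmf (irjmc_move n) x"

text \<open>The equation \<open>bind_pmf \<pi> K = \<pi>\<close> says \<open>\<pi>(m) = \<Sum>\<^sub>n \<pi>(n) K(n, m)\<close> for all \<open>m\<close>.\<close>

definition irjmc_stationary :: "nat \<Rightarrow> nat pmf \<Rightarrow> nat list pmf \<Rightarrow> bool" where
  "irjmc_stationary b x \<pi> \<longleftrightarrow>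
     set_pmf \<pi> \<subseteq> irjmc_configs b \<and> bind_pmf \<pi> (irjmc_kernel x) = \<pi>"

definition irjmc_z :: "nat pmf \<Rightarrow> nat \<Rightarrow> real" where
  "irjmc_z x i = (\<Sum>j\<le>i. pmf x j)"

text \<open>With \<open>n\<^sub>0 = 0\<close>, the entry \<open>n\<^sub>i\<close> is \<open>(0 # n) ! i\<close> for \<open>0 \<le> i \<le> b\<close>. The truncated
  subtraction in the exponent is exact on configurations.\<close>

definition irjmc_weight :: "nat \<Rightarrow> nat pmf \<Rightarrow> nat list \<Rightarrow> real" where
  "irjmc_weight b x n =
     (\<Prod>i<b. irjmc_z x i ^ ((0 # n) ! (i + 1) - (0 # n) ! i - 1))"

text \<open>An infinite sum that does not converge has the value \<open>0\<close> here, so uses of this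
  constant need summability of the weights.\<close>

definition irjmc_Z :: "nat \<Rightarrow> nat pmf \<Rightarrow> real" where
  "irjmc_Z b x = (\<Sum>\<^sub>\<infinity>n\<in>irjmc_configs b. irjmc_weight b x n)"

end

theory Submission
  imports Defs
begin

text \<open>
  If \<open>x\<^sub>b > 0\<close>, then \<open>z\<^sub>i < 1\<close> for \<open>i < b\<close>, and the normalised weight is the law of a configuration whose
  gaps \<open>n\<^sub>i\<^sub>+\<^sub>1 - n\<^sub>i - 1\<close> (\<open>0 \<le> i < b\<close>) are independent and geometric with parameters \<open>1 - z\<^sub>i\<close>.
  For stationarity, consider the predecessors of \<open>(1, a\<^sub>1 + 1, \<dots>, a\<^sub>b\<^sub>-\<^sub>1 + 1)\<close>: they insert one entry
  into \<open>a\<close>. With \<open>x\<^sub>i = z\<^sub>i - z\<^sub>i\<^sub>-\<^sub>1\<close> and \<open>g = a\<^sub>i - a\<^sub>i\<^sub>-\<^sub>1 - 1\<close>, inserting into the \<open>i\<close>-th gap of \<open>a\<close>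
  contributes the factor \<open>z\<^sub>i\<^sup>g - z\<^sub>i\<^sub>-\<^sub>1\<^sup>g\<close>, and the sum over \<open>i\<close> telescopes.

  For uniqueness, the first \<open>j + 1\<close> entries after a move depend only on the first \<open>j + 1\<close> entries
  before it, and after move \<open>b\<close> only on the first \<open>j\<close>. So if two stationary laws agree on the first
  \<open>j\<close> entries, every step contracts their difference on the first \<open>j + 1\<close> entries by \<open>1 - x\<^sub>b\<close>.

  If \<open>x\<^sub>b = 0\<close>, the last entry grows by one in every step, so there is no stationary law.
\<close>

section \<open>Gap weights and the law with independent geometric gaps\<close>

definition gap_weight :: "(nat \<Rightarrow> real) \<Rightarrow> nat \<Rightarrow> nat list \<Rightarrow> real" where
  "gap_weight z c l = (\<Prod>i<length l. z i ^ ((c # l) ! (i + 1) - (c # l) ! i - 1))"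

lemma gap_weight_Nil [simp]: "gap_weight z c [] = 1"
  by (simp add: gap_weight_def)

lemma gap_weight_Cons [simp]:
  "gap_weight z c (h # t) = z 0 ^ (h - c - 1) * gap_weight (\<lambda>i. z (Suc i)) h t"
  by (simp add: gap_weight_def prod.lessThan_Suc_shift del: prod.lessThan_Suc)

lemma gap_weight_map_Suc: "gap_weight z (Suc c) (map Suc l) = gap_weight z c l"
  by (induction l arbitrary: z c) simp_all

lemma irjmc_weight_eq: "length n = b \<Longrightarrow> irjmc_weight b x n = gap_weight (irjmc_z x) 0 n"
  by (simp add: irjmc_weight_def gap_weight_def)

lemma irjmc_configs_eq: "irjmc_configs b = {n. length n = b \<and> sorted_wrt (<) (0 # n)}"
  by (auto simp: irjmc_configs_def Suc_le_eq)

text \<open>Here \<open>c\<close> is the entry before the list. Both \<open>c\<close> and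
  \<open>z\<close> vary so that a tail has the same form again, with the head as new
  \<open>c\<close> and \<open>z\<close> shifted by one. If \<open>z 0\<close> lies in [0, 1), the
  success probability \<open>1 - z 0\<close> gives the gap \<open>g\<close> the mass
  \<open>(1 - z 0) * z 0 ^ g\<close>.\<close>

primrec gap_pmf :: "nat \<Rightarrow> (nat \<Rightarrow> real) \<Rightarrow> nat \<Rightarrow> nat list pmf" where
  "gap_pmf 0 z c = return_pmf []"
| "gap_pmf (Suc b) z c = bind_pmf (geometric_pmf (1 - z 0))
     (\<lambda>g. map_pmf ((#) (Suc (c + g))) (gap_pmf b (\<lambda>i. z (Suc i)) (Suc (c + g))))"

lemma set_gap_pmf: "set_pmf (gap_pmf b z c) \<subseteq> {l. length l = b \<and> sorted_wrt (<) (c # l)}"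
proof (induction b arbitrary: z c)
  case 0
  then show ?case by simp
next
  case (Suc b)
  show ?case
  proof
    fix l
    assume "l \<in> set_pmf (gap_pmf (Suc b) z c)"
    then obtain g t where t: "l = (Suc (c + g)) # t" "t \<in> set_pmf (gap_pmf b (\<lambda>i. z (Suc i)) (Suc (c + g)))"
      by auto
    then have "length t = b" "sorted_wrt (<) ((Suc (c + g)) # t)"
      using Suc.IH by blast+
    with t(1) show "l \<in> {l. length l = Suc b \<and> sorted_wrt (<) (c # l)}"
      by fastforce
  qed
qed

lemma pmf_map_Cons: "pmf (map_pmf ((#) k) M) (h # t) = (if k = h then pmf M t else 0)"
proof (cases "k = h")
  case True
  then show ?thesis by (simp add: pmf_map_inj')
next
  case False
  then show ?thesis by (auto simp: pmf_eq_0_set_pmf)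
qed

text \<open>The head \<open>h\<close> forces \<open>g = h - c - 1\<close>, so a single term of the
  mixture survives.\<close>

lemma pmf_bind_map_Cons:
  fixes c h :: nat
  assumes "c < h"
  shows "pmf (bind_pmf G (\<lambda>g. map_pmf ((#) (Suc (c + g))) (F g))) (h # t) =
    pmf G (h - c - 1) * pmf (F (h - c - 1)) t"
  unfolding pmf_bind
  by (subst integral_measure_pmf[where A = "{h - c - 1}"])
    (use assms in \<open>auto simp: pmf_map_Cons split: if_splits\<close>)

lemma pmf_gap_pmf:
  assumes "\<And>i. i < length l \<Longrightarrow> 0 \<le> z i \<and> z i < 1" and "sorted_wrt (<) (c # l)"
  shows "pmf (gap_pmf (length l) z c) l = (\<Prod>i<length l. 1 - z i) * gap_weight z c l"
  using assms
proof (induction l arbitrary: z c)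
  case Nil
  then show ?case by simp
next
  case (Cons h t)
  have z0: "0 \<le> z 0" "z 0 < 1"
    using Cons.prems(1)[of 0] by auto
  have "pmf (gap_pmf (length t) (\<lambda>i. z (Suc i)) h) t =
      (\<Prod>i<length t. 1 - z (Suc i)) * gap_weight (\<lambda>i. z (Suc i)) h t"
    using Cons.prems by (intro Cons.IH) auto
  moreover have "c < h"
    using Cons.prems(2) by simp
  ultimately show ?case
    using z0 by (simp add: pmf_bind_map_Cons prod.lessThan_Suc_shift del: prod.lessThan_Suc)
qed

section \<open>Deleting one entry under the geometric-gap law\<close>

definition delete_nth :: "nat \<Rightarrow> 'a list \<Rightarrow> 'a list" where
  "delete_nth i l = take i l @ drop (Suc i) l"

lemma delete_nth_Cons [simp]:
  "delete_nth 0 (h # t) = t"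
  "delete_nth (Suc i) (h # t) = h # delete_nth i t"
  by (simp_all add: delete_nth_def)

text \<open>Counting entries from 0 turns move \<open>Suc i\<close> into the deletion of entry
  \<open>i\<close>, which fits recursion on lists.\<close>

lemma irjmc_move_simps [simp]:
  "irjmc_move n 0 = map Suc n"
  "irjmc_move n (Suc i) = 1 # map Suc (delete_nth i n)"
  by (simp_all add: irjmc_move_def delete_nth_def)

lemma map_delete_nth_gap_pmf_0:
  "map_pmf (delete_nth 0) (gap_pmf (Suc b) z c) =
    bind_pmf (geometric_pmf (1 - z 0)) (\<lambda>g. gap_pmf b (\<lambda>i. z (Suc i)) (Suc (c + g)))"
  by (simp add: map_bind_pmf map_pmf_comp)

lemma map_delete_nth_gap_pmf_Suc:
  "map_pmf (delete_nth (Suc i)) (gap_pmf (Suc b) z c) =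
    bind_pmf (geometric_pmf (1 - z 0)) (\<lambda>g. map_pmf ((#) (Suc (c + g)))
      (map_pmf (delete_nth i) (gap_pmf b (\<lambda>i. z (Suc i)) (Suc (c + g)))))"
  by (simp add: map_bind_pmf map_pmf_comp)

text \<open>The deleted entry \<open>Suc (c + g)\<close> lies strictly between \<open>c\<close> and
  \<open>h\<close> and splits the gap \<open>m = h - c - 1\<close> into \<open>g\<close> and
  \<open>m - Suc g\<close>. The sum of \<open>z 0 ^ g * z 1 ^ (m - Suc g)\<close> over
  \<open>g < m\<close>, times \<open>z 1 - z 0\<close>, is \<open>z 1 ^ m - z 0 ^ m\<close>.\<close>

lemma pmf_delete_hd_gap_pmf:
  assumes z: "\<And>i. i \<le> Suc (length t) \<Longrightarrow> 0 \<le> z i \<and> z i < 1"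
    and l: "sorted_wrt (<) (c # h # t)"
  shows "(z 1 - z 0) * pmf (map_pmf (delete_nth 0) (gap_pmf (Suc (Suc (length t))) z c)) (h # t) =
    (\<Prod>i<Suc (Suc (length t)). 1 - z i) * (z 1 ^ (h - c - 1) - z 0 ^ (h - c - 1)) *
      gap_weight (\<lambda>i. z (Suc (Suc i))) h t"
proof -
  define m where "m = h - c - 1"
  \<comment> \<open>These are the factors that do not depend on the place of the deleted
    entry.\<close>
  define C where "C = (\<Prod>i<Suc (length t). 1 - z (Suc i)) * gap_weight (\<lambda>i. z (Suc (Suc i))) h t"
  have z0: "0 \<le> z 0" "z 0 < 1"
    using z[of 0] by auto
  have h: "c < h"
    using l by simp
  have zero: "pmf (gap_pmf (Suc (length t)) (\<lambda>i. z (Suc i)) (Suc (c + g))) (h # t) = 0" if "m \<le> g" for g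
    using set_gap_pmf[of "Suc (length t)" "\<lambda>i. z (Suc i)" "Suc (c + g)"] that h
    unfolding pmf_eq_0_set_pmf m_def by fastforce
  have pos: "pmf (gap_pmf (Suc (length t)) (\<lambda>i. z (Suc i)) (Suc (c + g))) (h # t) = z 1 ^ (m - Suc g) * C"
    if "g < m" for g
  proof -
    have "h - (Suc (c + g)) - 1 = m - Suc g"
      using that by (simp add: m_def)
    moreover have "pmf (gap_pmf (length (h # t)) (\<lambda>i. z (Suc i)) (Suc (c + g))) (h # t) =
        (\<Prod>i<length (h # t). 1 - z (Suc i)) * gap_weight (\<lambda>i. z (Suc i)) (Suc (c + g)) (h # t)"
      using z l that by (intro pmf_gap_pmf) (auto simp: m_def)
    ultimately show ?thesis
      by (simp add: C_def)
  qed
  have "pmf (map_pmf (delete_nth 0) (gap_pmf (Suc (Suc (length t))) z c)) (h # t) =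
      (\<Sum>g<m. (1 - z 0) * z 0 ^ g * (z 1 ^ (m - Suc g) * C))"
    unfolding map_delete_nth_gap_pmf_0 pmf_bind
  proof (subst integral_measure_pmf[where A = "{..<m}"], goal_cases)
    case (2 g)
    then show ?case using zero by (meson lessThan_iff not_less)
  next
    case 3
    then show ?case using z0 by (intro sum.cong) (simp_all add: pos del: gap_pmf.simps)
  qed simp
  also have "\<dots> = (1 - z 0) * C * (\<Sum>g<m. z 1 ^ (m - Suc g) * z 0 ^ g)"
    by (simp add: sum_distrib_left mult_ac)
  finally have "(z 1 - z 0) * pmf (map_pmf (delete_nth 0) (gap_pmf (Suc (Suc (length t))) z c)) (h # t) =
      (1 - z 0) * C * ((z 1 - z 0) * (\<Sum>g<m. z 1 ^ (m - Suc g) * z 0 ^ g))"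
    by simp
  also have "(z 1 - z 0) * (\<Sum>g<m. z 1 ^ (m - Suc g) * z 0 ^ g) = z 1 ^ m - z 0 ^ m"
    using power_diff_sumr2[of "z 0" m "z 1"] unfolding left_diff_distrib by linarith
  finally show ?thesis
    by (simp add: m_def C_def prod.lessThan_Suc_shift del: prod.lessThan_Suc gap_pmf.simps)
qed

text \<open>Let \<open>m\<close> be the gap between \<open>c\<close> and the head of
  \<open>a\<close>. Entries deleted behind the head keep the factor \<open>z 0 ^ m\<close>, one
  deleted before it contributes \<open>z 1 ^ m - z 0 ^ m\<close>, and together they give
  \<open>z 1 ^ m\<close>. An entry deleted behind all of \<open>a\<close> has no upper bound: its
  gap has total mass 1, and \<open>z (Suc (length a)) = 1\<close> makes its coefficient
  \<open>1 - z (length a)\<close>.\<close>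

lemma sum_pmf_delete_nth_gap_pmf:
  assumes "\<And>i. i \<le> length a \<Longrightarrow> 0 \<le> z i \<and> z i < 1" and "z (Suc (length a)) = 1"
    and "sorted_wrt (<) (c # a)"
  shows "(\<Sum>i<Suc (length a). (z (Suc i) - z i) *
      pmf (map_pmf (delete_nth i) (gap_pmf (Suc (length a)) z c)) a) =
    (\<Prod>i<Suc (length a). 1 - z i) * gap_weight (\<lambda>i. z (Suc i)) c a"
  using assms
proof (induction a arbitrary: z c)
  case Nil
  then show ?case
    by (simp add: map_bind_pmf delete_nth_def map_pmf_comp)
next
  case (Cons h t)
  have z0: "0 \<le> z 0" "z 0 < 1"
    using Cons.prems(1)[of 0] by auto
  have h: "c < h"
    using Cons.prems(3) by simp
  have IH: "(\<Sum>i<Suc (length t). (z (Suc (Suc i)) - z (Suc i)) *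
      pmf (map_pmf (delete_nth i) (gap_pmf (Suc (length t)) (\<lambda>i. z (Suc i)) h)) t) =
    (\<Prod>i<Suc (length t). 1 - z (Suc i)) * gap_weight (\<lambda>i. z (Suc (Suc i))) h t"
    using Cons.prems by (intro Cons.IH) auto
  have "(\<Sum>i<Suc (length t). (z (Suc (Suc i)) - z (Suc i)) *
      pmf (map_pmf (delete_nth (Suc i)) (gap_pmf (Suc (Suc (length t))) z c)) (h # t)) =
    (1 - z 0) * z 0 ^ (h - c - 1) * (\<Sum>i<Suc (length t). (z (Suc (Suc i)) - z (Suc i)) *
      pmf (map_pmf (delete_nth i) (gap_pmf (Suc (length t)) (\<lambda>i. z (Suc i)) h)) t)"
    unfolding map_delete_nth_gap_pmf_Suc pmf_bind_map_Cons[OF h] sum_distrib_left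
    using z0 h by (intro sum.cong) (simp_all del: gap_pmf.simps)
  moreover have "(z 1 - z 0) * pmf (map_pmf (delete_nth 0) (gap_pmf (Suc (Suc (length t))) z c)) (h # t) =
    (\<Prod>i<Suc (Suc (length t)). 1 - z i) * (z 1 ^ (h - c - 1) - z 0 ^ (h - c - 1)) *
      gap_weight (\<lambda>i. z (Suc (Suc i))) h t"
    using Cons.prems by (intro pmf_delete_hd_gap_pmf) auto
  ultimately show ?case
    unfolding IH length_Cons sum.lessThan_Suc_shift[of _ "Suc (length t)"]
      prod.lessThan_Suc_shift[of _ "Suc (length t)"]
    by (simp add: algebra_simps del: gap_pmf.simps prod.lessThan_Suc sum.lessThan_Suc)
qed

section \<open>One step of the chain and stationarity of the geometric-gap law\<close>

lemma irjmc_step_eq: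
  "bind_pmf \<pi> (irjmc_kernel x) = bind_pmf x (\<lambda>i. map_pmf (\<lambda>n. irjmc_move n i) \<pi>)"
  unfolding irjmc_kernel_def[abs_def] map_pmf_def by (rule bind_commute_pmf)

text \<open>The move is independent of the configuration and can be drawn first, so a step is a
  finite mixture over the moves. Stationarity uses the identity for \<open>f\<close>, uniqueness
  uses functions of prefixes.\<close>

lemma pmf_map_irjmc_step:
  assumes "set_pmf x \<subseteq> {0..b}"
  shows "pmf (map_pmf f (bind_pmf \<pi> (irjmc_kernel x))) v =
    (\<Sum>i\<le>b. pmf x i * pmf (map_pmf (\<lambda>n. f (irjmc_move n i)) \<pi>) v)"
  unfolding irjmc_step_eq map_bind_pmf pmf_bind
  by (subst integral_measure_pmf[where A = "{..b}"]) (use assms in \<open>auto simp: map_pmf_comp\<close>)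

lemma irjmc_move_configs:
  assumes "n \<in> irjmc_configs b" and "i \<le> b"
  shows "irjmc_move n i \<in> irjmc_configs b"
proof (cases i)
  case 0
  then show ?thesis
    using assms by (auto simp: irjmc_configs_def sorted_wrt_map)
next
  case (Suc j)
  have n: "length n = b" "sorted_wrt (<) n" "\<forall>k\<in>set n. 1 \<le> k"
    using assms(1) by (auto simp: irjmc_configs_def)
  have "sorted_wrt (<) (take j n @ n ! j # drop (Suc j) n)"
    using n Suc assms(2) by (simp add: id_take_nth_drop[symmetric])
  then have "sorted_wrt (<) (delete_nth j n)"
    by (auto simp: delete_nth_def sorted_wrt_append)
  moreover have "\<forall>k\<in>set (delete_nth j n). 1 \<le> k"
    using n(3) by (auto simp: delete_nth_def dest: in_set_takeD in_set_dropD)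
  moreover have "length (delete_nth j n) = b - 1"
    using n(1) Suc assms(2) by (simp add: delete_nth_def)
  ultimately show ?thesis
    using Suc assms(2) by (auto simp: irjmc_configs_def sorted_wrt_map)
qed

lemma irjmc_z_bounds:
  assumes "set_pmf x \<subseteq> {0..b}" and "pmf x b > 0" and "i < b"
  shows "0 \<le> irjmc_z x i" and "irjmc_z x i < 1"
proof -
  show "0 \<le> irjmc_z x i"
    by (simp add: irjmc_z_def sum_nonneg)
  have "irjmc_z x i + pmf x b = (\<Sum>j\<in>insert b {..i}. pmf x j)"
    using assms(3) by (simp add: irjmc_z_def)
  also have "\<dots> \<le> (\<Sum>j\<le>b. pmf x j)"
    using assms(3) by (intro sum_mono2) auto
  also have "\<dots> = 1"
    using assms(1) by (intro sum_pmf_eq_1) auto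
  finally show "irjmc_z x i < 1"
    using assms(2) by simp
qed

lemma irjmc_z_b: "set_pmf x \<subseteq> {0..b} \<Longrightarrow> irjmc_z x b = 1"
  unfolding irjmc_z_def by (intro sum_pmf_eq_1) auto

text \<open>The first entry of \<open>m\<close> tells which moves lead to it: move \<open>0\<close>
  makes it at least 2, every other move makes it 1. For the empty configuration, move
  \<open>0\<close> has probability 1.\<close>

lemma pmf_irjmc_step_gap_pmf:
  assumes x: "set_pmf x \<subseteq> {0..b}" "pmf x b > 0" and m: "m \<in> irjmc_configs b"
  shows "pmf (bind_pmf (gap_pmf b (irjmc_z x) 0) (irjmc_kernel x)) m = pmf (gap_pmf b (irjmc_z x) 0) m"
proof -
  let ?z = "irjmc_z x"
  let ?P = "gap_pmf b ?z 0"
  have step: "pmf (bind_pmf ?P (irjmc_kernel x)) m =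
      (\<Sum>i\<le>b. pmf x i * pmf (map_pmf (\<lambda>n. irjmc_move n i) ?P) m)"
    using pmf_map_irjmc_step[OF x(1), of "\<lambda>n. n"] by simp
  have len: "length m = b" and srt: "sorted_wrt (<) (0 # m)"
    using m by (auto simp: irjmc_configs_eq)
  have pm: "pmf ?P n = (\<Prod>i<b. 1 - ?z i) * gap_weight ?z 0 n" if "n \<in> irjmc_configs b" for n
    using pmf_gap_pmf[of n ?z 0] that irjmc_z_bounds[OF x] by (simp add: irjmc_configs_eq)
  consider "m = []" | t where "m = 1 # t" | h t where "m = Suc h # t" "0 < h"
    using srt by (cases m) (simp, metis One_nat_def gr0_conv_Suc list.set_intros(1) not_gr_zero sorted_wrt.simps(2))
  then show ?thesis
  proof cases
    case 1
    then show ?thesis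
      using step len irjmc_z_b[OF x(1)] by (simp add: irjmc_z_def)
  next
    case (2 t)
    define a where "a = map (\<lambda>k. k - 1) t"
    have t: "t = map Suc a"
      using srt 2 by (auto simp: a_def intro!: map_idI[symmetric])
    have b: "b = Suc (length a)"
      using len 2 t by simp
    have a: "sorted_wrt (<) (0 # a)"
      using srt 2 t by (simp add: sorted_wrt_map)
    have "pmf (map_pmf (\<lambda>n. irjmc_move n 0) ?P) m = 0"
      unfolding pmf_eq_0_set_pmf using 2 set_gap_pmf[of b ?z 0]
      by (auto simp: Cons_eq_map_conv)
    moreover have "pmf (map_pmf (\<lambda>n. irjmc_move n (Suc i)) ?P) m = pmf (map_pmf (delete_nth i) ?P) a" for i
    proof -
      have "inj (\<lambda>l. 1 # map Suc l)"
        by (auto intro!: injI)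
      moreover have "map_pmf (\<lambda>n. irjmc_move n (Suc i)) ?P = map_pmf (\<lambda>l. 1 # map Suc l) (map_pmf (delete_nth i) ?P)"
        by (simp add: map_pmf_comp)
      ultimately show ?thesis
        using 2 t pmf_map_inj' by metis
    qed
    ultimately have "pmf (bind_pmf ?P (irjmc_kernel x)) m =
        (\<Sum>i<b. pmf x (Suc i) * pmf (map_pmf (delete_nth i) ?P) a)"
      unfolding step lessThan_Suc_atMost[symmetric] sum.lessThan_Suc_shift by simp
    also have "\<dots> = (\<Sum>i<Suc (length a). (?z (Suc i) - ?z i) *
        pmf (map_pmf (delete_nth i) (gap_pmf (Suc (length a)) ?z 0)) a)"
      unfolding b by (simp add: irjmc_z_def)
    also have "\<dots> = (\<Prod>i<Suc (length a). 1 - ?z i) * gap_weight (\<lambda>i. ?z (Suc i)) 0 a"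
      using irjmc_z_bounds[OF x] irjmc_z_b[OF x(1)] a b
      by (intro sum_pmf_delete_nth_gap_pmf) auto
    \<comment> \<open>The first entry 1 has gap 0, so \<open>?z 0\<close> contributes 1; the
      remaining weight starts at 1 and is invariant under the shift by one.\<close>
    also have "gap_weight (\<lambda>i. ?z (Suc i)) 0 a = gap_weight ?z 0 m"
      using 2 t gap_weight_map_Suc[of _ 0] by simp
    finally show ?thesis
      using pm[OF m] b by simp
  next
    case (3 h t)
    define a where "a = h # map (\<lambda>k. k - 1) t"
    have t: "m = map Suc a"
      using srt 3 by (auto simp: a_def intro!: map_idI[symmetric])
    have a: "a \<in> irjmc_configs b"
      using m 3 unfolding t by (auto simp: irjmc_configs_def sorted_wrt_map a_def Suc_le_eq)
    have "pmf (map_pmf (\<lambda>n. irjmc_move n (Suc i)) ?P) m = 0" for i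
      unfolding pmf_eq_0_set_pmf using 3 by auto
    moreover have "pmf (map_pmf (\<lambda>n. irjmc_move n 0) ?P) m = pmf ?P a"
      unfolding t irjmc_move_simps by (rule pmf_map_inj') simp
    ultimately have "pmf (bind_pmf ?P (irjmc_kernel x)) m = ?z 0 * pmf ?P a"
      unfolding step lessThan_Suc_atMost[symmetric] sum.lessThan_Suc_shift
      by (simp add: irjmc_z_def)
    \<comment> \<open>Move \<open>0\<close> lengthens the first gap by one and keeps all
      others.\<close>
    also have "?z 0 * gap_weight ?z 0 a = gap_weight ?z 0 m"
    proof -
      have "?z 0 ^ h = ?z 0 * ?z 0 ^ (h - 1)"
        using 3(2) by (cases h) auto
      then show ?thesis
        unfolding t by (simp add: a_def gap_weight_map_Suc del: list.map_comp map_map)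
    qed
    then have "?z 0 * pmf ?P a = pmf ?P m"
      using pm[OF a] pm[OF m] by (simp add: mult_ac)
    finally show ?thesis .
  qed
qed

lemma irjmc_stationary_gap_pmf:
  assumes x: "set_pmf x \<subseteq> {0..b}" "pmf x b > 0"
  shows "irjmc_stationary b x (gap_pmf b (irjmc_z x) 0)"
proof -
  let ?P = "gap_pmf b (irjmc_z x) 0"
  have supp: "set_pmf ?P \<subseteq> irjmc_configs b"
    using set_gap_pmf by (simp add: irjmc_configs_eq)
  then have supp': "set_pmf (bind_pmf ?P (irjmc_kernel x)) \<subseteq> irjmc_configs b"
    using x(1) by (auto simp: irjmc_kernel_def intro!: irjmc_move_configs)
  have "pmf (bind_pmf ?P (irjmc_kernel x)) m = pmf ?P m" for m
  proof (cases "m \<in> irjmc_configs b")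
    case True
    then show ?thesis using pmf_irjmc_step_gap_pmf[OF x] by simp
  next
    case False
    then show ?thesis using supp supp' by (metis pmf_eq_0_set_pmf subsetD)
  qed
  then show ?thesis
    using supp by (auto simp: irjmc_stationary_def intro: pmf_eqI)
qed

section \<open>Uniqueness by contraction on prefixes\<close>

lemma take_delete_nth_ge: "j \<le> i \<Longrightarrow> take j (delete_nth i l) = take j l"
  by (cases "length l \<le> i") (auto simp: delete_nth_def min_def)

lemma take_delete_nth_lt: "i < j \<Longrightarrow> take j (delete_nth i l) = delete_nth i (take (Suc j) l)"
  by (cases "length l \<le> i") (auto simp: delete_nth_def min_def take_drop)

text \<open>The new entry 1 in front makes up for the deleted one, so no entry moves to a smaller
  index.\<close>

lemma take_irjmc_move:
  "take (Suc j) (irjmc_move n i) = take (Suc j) (irjmc_move (take (Suc j) n) i)"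
proof (cases i)
  case 0
  then show ?thesis by (simp add: take_map)
next
  case (Suc k)
  have "take j (delete_nth k n) = take j (delete_nth k (take (Suc j) n))"
    by (cases "j \<le> k") (simp_all add: take_delete_nth_ge take_delete_nth_lt)
  then show ?thesis
    using Suc by (simp add: take_map)
qed

lemma irjmc_stationary_map_take_eq:
  assumes x: "set_pmf x \<subseteq> {0..b}" "pmf x b > 0"
    and \<pi>: "irjmc_stationary b x \<pi>" "irjmc_stationary b x \<pi>'"
    and "j \<le> b"
  shows "map_pmf (take j) \<pi> = map_pmf (take j) \<pi>'"
  using \<open>j \<le> b\<close>
proof (induction j)
  case 0
  then show ?case by (simp add: map_pmf_const)
next
  case (Suc j)
  then have eq_j: "map_pmf (take j) \<pi> = map_pmf (take j) \<pi>'"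
    by simp
  define r where "r = 1 - pmf x b"
  have r: "0 \<le> r" "r < 1"
    using x(2) by (auto simp: r_def pmf_le_1)
  let ?d = "\<lambda>g v. pmf (map_pmf (\<lambda>n. g (take (Suc j) n)) \<pi>) v - pmf (map_pmf (\<lambda>n. g (take (Suc j) n)) \<pi>') v"
  \<comment> \<open>The bound ranges over all functions \<open>g\<close> of the prefix because a
    step replaces \<open>g\<close> by its composition with a move.\<close>
  have bound: "\<bar>?d g v\<bar> \<le> r ^ k" for k and g :: "nat list \<Rightarrow> nat list" and v
  proof (induction k arbitrary: g)
    case 0
    show ?case
      by (simp add: abs_le_iff diff_le_eq add_increasing2 pmf_le_1)
  next
    case (Suc k)
    let ?g = "\<lambda>i n. g (take (Suc j) (irjmc_move n i))"
    have g_move: "?g i (take (Suc j) n) = ?g i n" for i n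
      by (rule arg_cong[OF take_irjmc_move[symmetric]])
    have last: "map_pmf (\<lambda>n. ?g b (take (Suc j) n)) \<rho> =
        map_pmf (\<lambda>l. g (1 # map Suc l)) (map_pmf (take j) \<rho>)"
      if \<rho>: "irjmc_stationary b x \<rho>" for \<rho>
      unfolding map_pmf_comp
    proof (intro map_pmf_cong refl)
      fix n
      assume "n \<in> set_pmf \<rho>"
      obtain b' where b': "b = Suc b'" "j \<le> b'"
        using \<open>Suc j \<le> b\<close> by (cases b) auto
      have "take (Suc j) (irjmc_move n b) = 1 # map Suc (take j n)"
        using b' by (simp add: take_map take_delete_nth_ge)
      then show "?g b (take (Suc j) n) = g (1 # map Suc (take j n))"
        by (subst take_irjmc_move[symmetric]) simp
    qed
    have step: "pmf (map_pmf (\<lambda>n. g (take (Suc j) n)) \<rho>) v =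
        (\<Sum>i\<le>b. pmf x i * pmf (map_pmf (\<lambda>n. ?g i (take (Suc j) n)) \<rho>) v)"
      if "irjmc_stationary b x \<rho>" for \<rho>
      using pmf_map_irjmc_step[OF x(1), of "\<lambda>n. g (take (Suc j) n)" \<rho> v] that
      unfolding irjmc_stationary_def g_move by simp
    have "?d g v = (\<Sum>i\<le>b. pmf x i * ?d (?g i) v)"
      by (simp only: step[OF \<pi>(1)] step[OF \<pi>(2)] right_diff_distrib sum_subtractf)
    \<comment> \<open>The term of move \<open>b\<close> depends only on the first \<open>j\<close>
      entries and cancels by \<open>eq_j\<close>; the remaining moves have total probability
      \<open>r\<close>.\<close>
    also have "\<dots> = (\<Sum>i<b. pmf x i * ?d (?g i) v)"
      unfolding lessThan_Suc_atMost[symmetric] sum.lessThan_Suc last[OF \<pi>(1)] last[OF \<pi>(2)] eq_j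
      by simp
    finally have "\<bar>?d g v\<bar> \<le> (\<Sum>i<b. \<bar>pmf x i * ?d (?g i) v\<bar>)"
      by (simp only: sum_abs)
    also have "\<dots> \<le> (\<Sum>i<b. pmf x i * r ^ k)"
      unfolding abs_mult by (intro sum_mono mult_mono Suc.IH) auto
    also have "\<dots> = r * r ^ k"
    proof -
      have "(\<Sum>i<Suc b. pmf x i) = 1"
        using x(1) by (intro sum_pmf_eq_1) auto
      then have "(\<Sum>i<b. pmf x i) = r"
        by (simp add: r_def)
      then show ?thesis
        by (simp add: sum_distrib_right[symmetric])
    qed
    finally show ?case by simp
  qed
  have zero: "\<bar>?d (\<lambda>l. l) v\<bar> \<le> 0" for v
  proof (rule LIMSEQ_le_const)
    show "(\<lambda>k. r ^ k) \<longlonglongrightarrow> 0"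
      using r by (intro LIMSEQ_power_zero) auto
  qed (use bound[of "\<lambda>l. l"] in simp)
  then show ?case
    by (intro pmf_eqI) (use zero in simp)
qed

lemma irjmc_stationary_unique:
  assumes "set_pmf x \<subseteq> {0..b}" "pmf x b > 0"
    and \<pi>: "irjmc_stationary b x \<pi>" "irjmc_stationary b x \<pi>'"
  shows "\<pi> = \<pi>'"
proof -
  have "map_pmf (take b) \<rho> = \<rho>" if "irjmc_stationary b x \<rho>" for \<rho>
    using that by (intro map_pmf_idI) (auto simp: irjmc_stationary_def irjmc_configs_def)
  then show ?thesis
    using irjmc_stationary_map_take_eq[OF assms order_refl] \<pi> by metis
qed

section \<open>Absence of a stationary law when \<open>x\<close> has no mass at
  \<open>b\<close>\<close>

lemma no_pmf_invariant_Suc: "map_pmf Suc p \<noteq> p"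
proof
  assume inv: "map_pmf Suc p = p"
  have "pmf p k = 0" for k
  proof (induction k)
    case 0
    have "0 \<notin> set_pmf (map_pmf Suc p)" by auto
    then show ?case
      using inv by (simp add: pmf_eq_0_set_pmf)
  next
    case (Suc k)
    then show ?case
      using pmf_map_inj'[of Suc p k] inv by simp
  qed
  then show False
    using set_pmf_not_empty[of p] by (auto simp: set_pmf_eq)
qed

text \<open>Only move \<open>b\<close> removes the last entry. Without it, the law of the last entry
  would be invariant under \<open>Suc\<close>.\<close>

lemma irjmc_stationary_imp_pos:
  assumes x: "set_pmf x \<subseteq> {0..b}" and \<pi>: "irjmc_stationary b x \<pi>"
  shows "pmf x b > 0"
proof (rule ccontr)
  assume "\<not> ?thesis"
  then have b0: "b \<notin> set_pmf x"
    by (simp add: pmf_positive_iff)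
  \<comment> \<open>For \<open>b = 0\<close> the support of \<open>x\<close> would be empty. Hence
    configurations are nonempty and \<open>last\<close> yields a genuine entry.\<close>
  then have "b \<noteq> 0"
    using x set_pmf_not_empty[of x] by auto
  have last_move: "last (irjmc_move n i) = Suc (last n)" if "n \<in> set_pmf \<pi>" "i \<in> set_pmf x" for n i
  proof -
    have n: "length n = b" "n \<noteq> []"
      using that(1) \<pi> \<open>b \<noteq> 0\<close> by (auto simp: irjmc_stationary_def irjmc_configs_def)
    have "i < b"
      using x that(2) b0 by (metis atLeastAtMost_iff le_neq_implies_less subsetD)
    then show ?thesis
      using n by (cases i) (auto simp: delete_nth_def last_map last_append)
  qed
  have "map_pmf last \<pi> = map_pmf last (bind_pmf \<pi> (irjmc_kernel x))"
    using \<pi> by (simp add: irjmc_stationary_def)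
  also have "\<dots> = bind_pmf \<pi> (\<lambda>n. map_pmf (\<lambda>i. last (irjmc_move n i)) x)"
    by (simp add: map_bind_pmf irjmc_kernel_def map_pmf_comp)
  also have "\<dots> = bind_pmf \<pi> (\<lambda>n. return_pmf (Suc (last n)))"
    using last_move by (intro bind_pmf_cong refl) (simp cong: map_pmf_cong add: map_pmf_const)
  also have "\<dots> = map_pmf Suc (map_pmf last \<pi>)"
    by (simp add: map_pmf_def bind_assoc_pmf bind_return_pmf)
  finally show False
    using no_pmf_invariant_Suc[of "map_pmf last \<pi>"] by simp
qed

section \<open>Normalisation and the product formula\<close>

lemma has_sum_pmf:
  assumes "set_pmf p \<subseteq> A"
  shows "(pmf p has_sum 1) A"
proof -
  have "Infinite_Sum.abs_summable_on (pmf p) A"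
    unfolding abs_summable_equivalent by (rule pmf_abs_summable)
  moreover have "infsum (pmf p) A = 1"
    using infsetsum_infsum[OF pmf_abs_summable, of p A] infsetsum_pmf_eq_1[OF assms] by simp
  ultimately show ?thesis
    using abs_summable_summable has_sum_infsum by metis
qed

theorem theorem3p2:
  fixes b :: nat and x :: "nat pmf"
  assumes "set_pmf x \<subseteq> {0..b}"
  shows "(\<forall>\<pi>. irjmc_stationary b x \<pi> \<longrightarrow>
            irjmc_weight b x summable_on irjmc_configs b \<and>
            (\<forall>n\<in>irjmc_configs b. pmf \<pi> n = 1 / irjmc_Z b x * irjmc_weight b x n)) \<and>
         (pmf x b > 0 \<longrightarrow> (\<exists>!\<pi>. irjmc_stationary b x \<pi>))"
proof (intro conjI allI impI)
  assume "pmf x b > 0"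
  then show "\<exists>!\<pi>. irjmc_stationary b x \<pi>"
    using irjmc_stationary_gap_pmf irjmc_stationary_unique assms by metis
next
  fix \<pi>
  assume \<pi>: "irjmc_stationary b x \<pi>"
  \<comment> \<open>This is the normalising factor of the geometric-gap law; it turns out to be the
    reciprocal of \<open>irjmc_Z b x\<close>.\<close>
  define C where "C = (\<Prod>i<b. 1 - irjmc_z x i)"
  have pos: "pmf x b > 0"
    using irjmc_stationary_imp_pos[OF assms \<pi>] .
  have "C > 0"
    unfolding C_def using irjmc_z_bounds[OF assms pos] by (intro prod_pos) simp
  have "\<pi> = gap_pmf b (irjmc_z x) 0"
    using irjmc_stationary_unique[OF assms pos \<pi>] irjmc_stationary_gap_pmf[OF assms pos] .
  then have "pmf \<pi> n = C * irjmc_weight b x n" if "n \<in> irjmc_configs b" for n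
    using that pmf_gap_pmf[of n "irjmc_z x" 0] irjmc_z_bounds[OF assms pos]
    by (simp add: irjmc_configs_eq irjmc_weight_eq C_def)
  then have eq: "irjmc_weight b x n = inverse C * pmf \<pi> n" if "n \<in> irjmc_configs b" for n
    using that \<open>C > 0\<close> by simp
  have "(pmf \<pi> has_sum 1) (irjmc_configs b)"
    using \<pi> by (intro has_sum_pmf) (simp add: irjmc_stationary_def)
  then have "((\<lambda>n. inverse C * pmf \<pi> n) has_sum inverse C * 1) (irjmc_configs b)"
    by (rule has_sum_cmult_right)
  \<comment> \<open>Convergence to \<open>inverse C\<close> ensures that \<open>irjmc_Z b x\<close>
    is the actual sum and not the default value 0.\<close>
  then have "(irjmc_weight b x has_sum inverse C) (irjmc_configs b)"
    by (subst has_sum_cong[OF eq]) simp_all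
  then show "irjmc_weight b x summable_on irjmc_configs b"
    and "\<forall>n\<in>irjmc_configs b. pmf \<pi> n = 1 / irjmc_Z b x * irjmc_weight b x n"
    using eq \<open>C > 0\<close> by (auto simp: irjmc_Z_def infsumI summable_on_def field_simps)
qed

end
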